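(* Let $K$ be a division ring and $\mathrm{k}$ a subfield contained in the center of $K$. Let $V\neq\{0\}$ and $W$ be finite-dimensional $\mathrm{k}$-subspaces of $K$ such that $\dim_{\mathrm{k}}(W)\geq\dim_{\mathrm{k}}(V)$ and $\dim_{\mathrm{k}}(WV)\leq(2-\varepsilon)\dim_{\mathrm{k}}(V)$ for some real $\varepsilon$ with $0<\varepsilon<2$. Then one of the following holds: (a) there exist a sub division ring $H$ of $K$ containing $\mathrm{k}$ with $\dim_{\mathrm{k}}(H)\leq(\frac{2}{\varepsilon}-1)\dim_{\mathrm{k}}(V)$ and an element $x\in K^{\ast}$ such that $V\subseteq Hx$; (b) there exist a sub division ring $H$ of $K$ containing $\mathrm{k}$ with $\dim_{\mathrm{k}}(H)\leq\frac{\frac{2}{\varepsilon}-1}{\frac{2}{\varepsilon}+1}\dim_{\mathrm{k}}(V)$ and a finite subset $X$ of $K^{\ast}$ with $\left\vert X\right\vert \leq\frac{2}{\varepsilon}-1$ such that $V\subseteq\bigoplus_{x\in X}Hx$.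
   Context: $WV=\{wv\mid w\in W,v\in V\}$ and $\dim_{\mathrm{k}}(WV)$ is the dimension over $\mathrm{k}$ of its $\mathrm{k}$-linear span; $Hx=\{hx\mid h\in H\}$. *)

theory Defs
  imports Complex_Main "HOL-Algebra.Embedded_Algebras"
begin

text \<open>
  The library theory \<^theory>\<open>HOL-Algebra.Embedded_Algebras\<close> supplies linear algebra over a subfield
  \<open>k\<close> of a (not necessarily commutative) ring, scalars acting by left multiplication. In it,
  \<^locale>\<open>subalgebra\<close> \<open>k V K\<close> says that \<open>V\<close> is a \<open>k\<close>-subspace of \<open>K\<close> (an additive
  subgroup closed under scalars; no closure under products is asked), and \<open>ring.dim\<close> is only
  meaningful for subspaces satisfying \<open>ring.finite_dimension\<close>.
\<close>

text \<open>
  Division rings. As \<open>\<one>\<close> is always a unit, the unit condition entails \<open>\<one> \<noteq> \<zero>\<close>.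
\<close>

locale skew_field = ring +
  assumes skew_field_Units: "Units R = carrier R - {\<zero>}"

locale sub_skew_field = subring H R for H and R (structure) +
  assumes sub_skew_field_Units: "Units (R \<lparr> carrier := H \<rparr>) = H - {\<zero>}"

definition ring_center :: "('a, 'b) ring_scheme \<Rightarrow> 'a set"
  where "ring_center R =
    {z \<in> carrier R. \<forall>x \<in> carrier R. z \<otimes>\<^bsub>R\<^esub> x = x \<otimes>\<^bsub>R\<^esub> z}"

text \<open>
  The \<open>k\<close>-linear span of an arbitrary set: the additive subgroup generated by all scalar multiples.
  For the elements of a list it is the library's \<open>Span\<close>, by \<open>Span_eq_generate\<close>.
\<close>

definition linear_span :: "('a, 'b) ring_scheme \<Rightarrow> 'a set \<Rightarrow> 'a set \<Rightarrow> 'a set"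
  where "linear_span R k S = generate (add_monoid R) (k <#>\<^bsub>R\<^esub> S)"

text \<open>
  Sum of a family of additive subgroups, and its directness (unique decomposition). Both are meant
  for finite index sets only, since \<^const>\<open>finsum\<close> is \<open>\<zero>\<close> over infinite ones.
\<close>

definition family_sum :: "('a, 'b) ring_scheme \<Rightarrow> 'i set \<Rightarrow> ('i \<Rightarrow> 'a set) \<Rightarrow> 'a set"
  where "family_sum R I A = (\<lambda>f. finsum R f I) ` (\<Pi>\<^sub>E i\<in>I. A i)"

definition is_direct_sum :: "('a, 'b) ring_scheme \<Rightarrow> 'i set \<Rightarrow> ('i \<Rightarrow> 'a set) \<Rightarrow> bool"
  where "is_direct_sum R I A \<longleftrightarrow> inj_on (\<lambda>f. finsum R f I) (\<Pi>\<^sub>E i\<in>I. A i)"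

end

theory Submission
  imports Defs
begin

text \<open>
  For subspaces \<open>U\<close> put \<open>c(U) = dim UV - \<mu> dim U\<close> with \<open>\<mu> = 1 - \<epsilon> / 2\<close>.
  This function is submodular and invariant under left translation, so an atom (a nonzero minimiser
  of least dimension) that contains \<open>\<one>\<close> is unique, and it is a sub division ring \<open>H\<close>.
  A maximal direct family of cosets \<open>Hx\<close> with \<open>x \<in> V\<close> has a sum between \<open>V\<close>
  and \<open>HV\<close>; if it has \<open>m\<close> members, then \<open>c(H) \<le> c(W)\<close> gives
  \<open>(m - \<mu>) dim H \<le> \<mu> dim V \<le> \<mu> m dim H\<close>, from which all the bounds follow.
\<close>

section \<open>Additive maps of a ring and their effect on subgroups and dimensions\<close>

context ring
begin

text \<open>Supports arguments by generators: once a preimage is known to be a subgroup, it contains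
  everything generated by elements that are checked one by one.\<close>

lemma subgroup_add_vimage:
  assumes "subgroup E (add_monoid R)"
    and "f \<in> carrier R \<rightarrow> carrier R"
    and "\<And>x y. \<lbrakk> x \<in> carrier R; y \<in> carrier R \<rbrakk> \<Longrightarrow> f (x \<oplus> y) = f x \<oplus> f y"
  shows "subgroup {x \<in> carrier R. f x \<in> E} (add_monoid R)"
proof -
  have hom: "f \<in> hom (add_monoid R) (add_monoid R)"
    using assms(2,3) by (auto simp: hom_def)
  interpret f: group_hom "add_monoid R" "add_monoid R" f
    using hom by (simp add: group_hom_def group_hom_axioms_def add.is_group)
  have inv: "f (\<ominus> x) = \<ominus> f x" if "x \<in> carrier R" for x
    using f.hom_inv[of x] that by (simp add: a_inv_def)
  have zero: "f \<zero> = \<zero>" using f.hom_one by simp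
  show ?thesis
    using assms(2,3) subgroup.one_closed[OF assms(1)] add.subgroupE[OF assms(1)]
    by (intro add.subgroupI) (auto simp: inv zero)
qed

text \<open>An injective linear map carries each line extension to a line extension by a new vector,
  so the inductive construction of \<open>E\<close> is copied step by step. The second conjunct
  travels along because the laws for \<open>f\<close> hold only inside the carrier. The maps in view
  are the left and right multiplications by a nonzero element.\<close>

lemma dimension_image:
  assumes "k \<subseteq> carrier R"
    and f: "f \<in> carrier R \<rightarrow> carrier R" "inj_on f (carrier R)"
    and add: "\<And>x y. \<lbrakk> x \<in> carrier R; y \<in> carrier R \<rbrakk> \<Longrightarrow> f (x \<oplus> y) = f x \<oplus> f y"
    and smult: "\<And>c x. \<lbrakk> c \<in> k; x \<in> carrier R \<rbrakk> \<Longrightarrow> f (c \<otimes> x) = c \<otimes> f x"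
    and "dimension n k E"
  shows "dimension n k (f ` E) \<and> E \<subseteq> carrier R"
  \<comment> \<open>The scalars are an argument of the inductive predicate that varies in its
    induction rule, so the two facts about \<open>k\<close> have to pass through the
    induction.\<close>
  using assms(6,1,5)
proof (induction rule: dimension.induct)
  case zero_dim
  have "f \<zero> \<oplus> f \<zero> = f \<zero>"
    using add[of \<zero> \<zero>] by simp
  then have "f \<zero> = \<zero>"
    using f(1) by (metis add.l_cancel_one funcset_mem zero_closed)
  then show ?case by (simp add: dimension.zero_dim)
next
  case (Suc_dim v E n k)
  note smult = Suc_dim.prems(2)
  have IH: "dimension n k (f ` E)" and E: "E \<subseteq> carrier R" and v: "v \<in> carrier R"
    using Suc_dim.IH[OF Suc_dim.prems] Suc_dim.hyps(1) by auto
  have lin: "f (c \<otimes> v \<oplus> e) = c \<otimes> f v \<oplus> f e" if "c \<in> k" "e \<in> E" for c e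
    using that Suc_dim.prems(1) E v by (simp add: add smult subset_iff)
  have "f ` line_extension k v E = line_extension k (f v) (f ` E)"
  proof (intro equalityI subsetI)
    fix y assume "y \<in> f ` line_extension k v E"
    then obtain c e where ce: "c \<in> k" "e \<in> E" "y = f (c \<otimes> v \<oplus> e)"
      by (auto simp: line_extension_mem_iff)
    then show "y \<in> line_extension k (f v) (f ` E)"
      using lin by (auto simp: line_extension_mem_iff)
  next
    fix y assume "y \<in> line_extension k (f v) (f ` E)"
    then obtain c e where ce: "c \<in> k" "e \<in> E" "y = c \<otimes> f v \<oplus> f e"
      by (auto simp: line_extension_mem_iff)
    then have "y = f (c \<otimes> v \<oplus> e)"
      using lin by simp
    moreover have "c \<otimes> v \<oplus> e \<in> line_extension k v E"
      using ce(1,2) by (auto simp: line_extension_mem_iff)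
    ultimately show "y \<in> f ` line_extension k v E"
      by blast
  qed
  moreover have "f v \<notin> f ` E"
    using inj_on_image_mem_iff[OF f(2) v E] Suc_dim.hyps(2) by simp
  moreover have "f v \<in> carrier R"
    using f(1) v by blast
  ultimately show ?case
    using IH line_extension_in_carrier[OF Suc_dim.prems(1) v E]
    by (simp add: dimension.Suc_dim)
qed

section \<open>Sums of finite families of additive subgroups, one summand at a time\<close>

lemma set_add_memI: "\<lbrakk> a \<in> A; b \<in> B \<rbrakk> \<Longrightarrow> a \<oplus> b \<in> A <+>\<^bsub>R\<^esub> B"
  by (auto simp: set_add_def')

lemma family_sum_empty: "family_sum R {} A = {\<zero>}"
  by (simp add: family_sum_def)

lemma family_sum_insert:
  assumes "finite I" "i \<notin> I" and A: "\<And>j. j \<in> insert i I \<Longrightarrow> A j \<subseteq> carrier R"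
  shows "family_sum R (insert i I) A = A i <+>\<^bsub>R\<^esub> family_sum R I A"
proof -
  have upd: "finsum R (f(i := a)) (insert i I) = a \<oplus> finsum R f I"
    if "a \<in> A i" "f \<in> (\<Pi>\<^sub>E j\<in>I. A j)" for a f
  proof -
    have f: "f \<in> I \<rightarrow> carrier R" and a: "a \<in> carrier R"
      using that A by blast+
    have "finsum R (f(i := a)) I = finsum R f I"
      using f assms(2) by (intro finsum_cong') auto
    moreover have "f(i := a) \<in> I \<rightarrow> carrier R"
      using f assms(2) by auto
    ultimately show ?thesis
      using a assms(1,2) by simp
  qed
  show ?thesis
  proof (intro equalityI subsetI)
    fix x assume "x \<in> family_sum R (insert i I) A"
    then obtain a f where "a \<in> A i" "f \<in> (\<Pi>\<^sub>E j\<in>I. A j)" "x = finsum R (f(i := a)) (insert i I)"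
      unfolding family_sum_def PiE_insert_eq by auto
    then show "x \<in> A i <+>\<^bsub>R\<^esub> family_sum R I A"
      using upd unfolding family_sum_def set_add_def' by blast
  next
    fix x assume "x \<in> A i <+>\<^bsub>R\<^esub> family_sum R I A"
    then obtain a f where "a \<in> A i" "f \<in> (\<Pi>\<^sub>E j\<in>I. A j)" "x = a \<oplus> finsum R f I"
      unfolding family_sum_def set_add_def' by blast
    then show "x \<in> family_sum R (insert i I) A"
      using upd[of a f] unfolding family_sum_def PiE_insert_eq by force
  qed
qed

text \<open>If \<open>a + s = b + t\<close> with \<open>a\<close>, \<open>b\<close> in the new
  summand and \<open>s\<close>, \<open>t\<close> in the old sum, then \<open>a - b = t - s\<close>
  lies in both, hence vanishes. Directness of the old family then identifies the remaining
  components.\<close>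

lemma is_direct_sum_insert:
  assumes "finite I" "i \<notin> I" and A: "\<And>j. j \<in> insert i I \<Longrightarrow> subgroup (A j) (add_monoid R)"
    and direct: "is_direct_sum R I A"
    and disj: "A i \<inter> family_sum R I A = {\<zero>}" and sub: "subgroup (family_sum R I A) (add_monoid R)"
  shows "is_direct_sum R (insert i I) A"
  unfolding is_direct_sum_def
proof (rule inj_onI)
  fix f g
  assume f: "f \<in> (\<Pi>\<^sub>E j\<in>insert i I. A j)" and g: "g \<in> (\<Pi>\<^sub>E j\<in>insert i I. A j)"
    and eq: "finsum R f (insert i I) = finsum R g (insert i I)"
  have carr: "A j \<subseteq> carrier R" if "j \<in> insert i I" for j
    using add.subgroupE(1)[OF A[OF that]] by simp
  \<comment> \<open>The rest of \<open>h\<close> appears as \<open>restrict h I\<close>, since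
    injectivity in \<open>is_direct_sum\<close> is stated for extensional functions on the index
    set.\<close>
  have split: "\<exists>s. finsum R h (insert i I) = h i \<oplus> s \<and> s \<in> family_sum R I A \<and> h i \<in> A i
      \<and> s = finsum R (restrict h I) I \<and> restrict h I \<in> (\<Pi>\<^sub>E j\<in>I. A j)"
    if h: "h \<in> (\<Pi>\<^sub>E j\<in>insert i I. A j)" for h
  proof -
    have hI: "h \<in> I \<rightarrow> carrier R" "h i \<in> carrier R"
      using h carr by (auto simp: PiE_def Pi_def)
    have "finsum R (restrict h I) I = finsum R h I"
      using hI by (intro finsum_cong') auto
    moreover have "restrict h I \<in> (\<Pi>\<^sub>E j\<in>I. A j)" using h by auto
    moreover have "finsum R h (insert i I) = h i \<oplus> finsum R h I"
      using hI assms(1,2) by simp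
    moreover have "h i \<in> A i" using h by auto
    ultimately show ?thesis
      unfolding family_sum_def by (metis imageI)
  qed
  obtain s where s: "finsum R f (insert i I) = f i \<oplus> s" "s \<in> family_sum R I A" "f i \<in> A i"
      "s = finsum R (restrict f I) I" "restrict f I \<in> (\<Pi>\<^sub>E j\<in>I. A j)"
    using split[OF f] by blast
  obtain t where t: "finsum R g (insert i I) = g i \<oplus> t" "t \<in> family_sum R I A" "g i \<in> A i"
      "t = finsum R (restrict g I) I" "restrict g I \<in> (\<Pi>\<^sub>E j\<in>I. A j)"
    using split[OF g] by blast
  have in_carr: "f i \<in> carrier R" "g i \<in> carrier R" "s \<in> carrier R" "t \<in> carrier R"
    using s t carr[of i] add.subgroupE(1)[OF sub] by auto
  have e: "f i \<oplus> s = g i \<oplus> t" using eq s t by simp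
  have "f i \<ominus> g i = (f i \<oplus> s) \<ominus> g i \<ominus> s" using in_carr by algebra
  also have "\<dots> = t \<ominus> s" unfolding e using in_carr by algebra
  finally have fg: "f i \<ominus> g i = t \<ominus> s" .
  have "f i \<ominus> g i \<in> A i"
    using s t A[of i] unfolding a_minus_def by (simp add: add.subgroupE(3,4))
  moreover have "t \<ominus> s \<in> family_sum R I A"
    using s t sub unfolding a_minus_def by (simp add: add.subgroupE(3,4))
  ultimately have "f i \<ominus> g i = \<zero>" "t \<ominus> s = \<zero>" using disj fg by auto
  then have "f i = g i" "s = t" using in_carr by auto
  then have "restrict f I = restrict g I"
    using direct s(4,5) t(4,5) unfolding is_direct_sum_def by (metis inj_onD)
  then show "f = g"
    using \<open>f i = g i\<close> f g by (metis PiE_ext insertE restrict_apply')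
qed

end

section \<open>Inverses and cancellation in division rings\<close>

lemma (in skew_field) inv_nonzero:
  assumes "a \<in> carrier R" "a \<noteq> \<zero>"
  shows "inv a \<in> carrier R" "inv a \<noteq> \<zero>" "inv a \<otimes> a = \<one>" "a \<otimes> inv a = \<one>" "inv (inv a) = a"
proof -
  have "a \<in> Units R" using assms skew_field_Units by auto
  then show "inv a \<in> carrier R" "inv a \<noteq> \<zero>" "inv a \<otimes> a = \<one>" "a \<otimes> inv a = \<one>" "inv (inv a) = a"
    using Units_inv_Units[of a] skew_field_Units by auto
qed

lemma (in skew_field) l_cancel_nonzero:
  assumes "a \<in> carrier R - {\<zero>}" "x \<in> carrier R" "y \<in> carrier R" "a \<otimes> x = a \<otimes> y"
  shows "x = y"
  using assms by (metis Units_l_cancel skew_field_Units)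

lemma (in skew_field) r_cancel_nonzero:
  assumes "a \<in> carrier R - {\<zero>}" "x \<in> carrier R" "y \<in> carrier R" "x \<otimes> a = y \<otimes> a"
  shows "x = y"
  using assms by (metis DiffD1 DiffD2 inv_nonzero(1,4) m_assoc r_one singletonI)

text \<open>An inverse formed inside \<open>H\<close> is also one in the whole ring, and inverses
  are unique.\<close>

lemma sub_skew_field_nonzero_inv:
  assumes "skew_field R" "sub_skew_field H R" "h \<in> H" "h \<noteq> \<zero>\<^bsub>R\<^esub>"
  shows "inv\<^bsub>R\<^esub> h \<in> H"
proof -
  interpret skew_field R by fact
  interpret H: sub_skew_field H R by fact
  have "h \<in> Units (R \<lparr> carrier := H \<rparr>)"
    using assms(3,4) H.sub_skew_field_Units by auto
  then obtain g where "g \<in> H" "g \<otimes>\<^bsub>R\<^esub> h = \<one>\<^bsub>R\<^esub>" "h \<otimes>\<^bsub>R\<^esub> g = \<one>\<^bsub>R\<^esub>"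
    by (auto simp: Units_def)
  then show ?thesis
    using assms(3) H.mem_carrier by (metis inv_char)
qed

section \<open>Division rings over a central subfield, and the linearity of translations\<close>

locale skew_field_extension = skew_field R for k and R (structure) +
  assumes subfield: "subfield k R" and central: "k \<subseteq> ring_center R"
begin

lemma k_carrier: "k \<subseteq> carrier R"
  using subfieldE(3)[OF subfield] .

lemma k_commute: "c \<in> k \<Longrightarrow> x \<in> carrier R \<Longrightarrow> x \<otimes> c = c \<otimes> x"
  using central by (auto simp: ring_center_def)

text \<open>Centrality enters the linear algebra here: scalars act from the left, so left
  multiplication by \<open>a\<close> is linear because \<open>c\<close> commutes with
  \<open>a\<close>, whereas right multiplication is linear by associativity alone.\<close>

lemma k_left_commute:
  assumes "c \<in> k" "a \<in> carrier R" "x \<in> carrier R"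
  shows "a \<otimes> (c \<otimes> x) = c \<otimes> (a \<otimes> x)"
proof -
  have c: "c \<in> carrier R" using assms(1) k_carrier by blast
  then have "a \<otimes> (c \<otimes> x) = (a \<otimes> c) \<otimes> x" using assms by (simp add: m_assoc)
  also have "a \<otimes> c = c \<otimes> a" using assms(1,2) by (rule k_commute)
  finally show ?thesis using c assms by (simp add: m_assoc)
qed

lemma finite_dimension_subalgebra: "finite_dimension k E \<Longrightarrow> subalgebra k E R"
  by (rule finite_dimension_imp_subalgebra[OF subfield])

lemma finite_dimension_carrier: "finite_dimension k E \<Longrightarrow> E \<subseteq> carrier R"
  by (rule subalgebra_in_carrier[OF finite_dimension_subalgebra])

lemma dimension_dim: "finite_dimension k E \<Longrightarrow> dimension (dim k E) k E"
  using finite_dimensionE[OF subfield] by (simp add: over_def)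

lemma dim_eqI: "dimension n k E \<Longrightarrow> dim k E = n"
  using dimI[OF subfield] by (simp add: over_def)

text \<open>Applied to \<open>f\<close> a left or right multiplication, this lets a condition such
  as \<open>a \<otimes> x \<in> E\<close> be tested on a spanning list of the \<open>x\<close>
  only.\<close>

lemma subalgebra_vimage:
  assumes "subalgebra k E R" and "f \<in> carrier R \<rightarrow> carrier R"
    and "\<And>x y. \<lbrakk> x \<in> carrier R; y \<in> carrier R \<rbrakk> \<Longrightarrow> f (x \<oplus> y) = f x \<oplus> f y"
    and "\<And>c x. \<lbrakk> c \<in> k; x \<in> carrier R \<rbrakk> \<Longrightarrow> f (c \<otimes> x) = c \<otimes> f x"
  shows "subalgebra k {x \<in> carrier R. f x \<in> E} R"
  using subgroup_add_vimage[OF subalgebra.axioms(1)[OF assms(1)] assms(2,3)]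
    assms(4) k_carrier subalgebra.smult_closed[OF assms(1)]
  by (auto simp: subalgebra_def subalgebra_axioms_def)

lemma subalgebra_vimage_l_mult:
  assumes "subalgebra k E R" "a \<in> carrier R"
  shows "subalgebra k {x \<in> carrier R. a \<otimes> x \<in> E} R"
  using k_left_commute assms by (intro subalgebra_vimage) (auto simp: r_distr)

lemma subalgebra_vimage_r_mult:
  assumes "subalgebra k E R" "a \<in> carrier R"
  shows "subalgebra k {x \<in> carrier R. x \<otimes> a \<in> E} R"
  using k_carrier assms by (intro subalgebra_vimage) (auto simp: l_distr m_assoc)

lemma dimension_l_mult:
  assumes "dimension n k E" "a \<in> carrier R - {\<zero>}"
  shows "dimension n k ((\<otimes>) a ` E)"
proof -
  have "inj_on ((\<otimes>) a) (carrier R)"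
    using l_cancel_nonzero[OF assms(2)] by (auto intro: inj_onI)
  then show ?thesis
    using dimension_image[OF k_carrier _ _ _ _ assms(1), of "(\<otimes>) a"] assms(2)
    by (auto simp: r_distr k_left_commute)
qed

lemma dimension_r_mult:
  assumes "dimension n k E" "a \<in> carrier R - {\<zero>}"
  shows "dimension n k ((\<lambda>x. x \<otimes> a) ` E)"
proof -
  have "inj_on (\<lambda>x. x \<otimes> a) (carrier R)"
    using r_cancel_nonzero[OF assms(2)] by (auto intro: inj_onI)
  moreover have "c \<otimes> x \<otimes> a = c \<otimes> (x \<otimes> a)" if "c \<in> k" "x \<in> carrier R" for c x
    using that assms(2) k_carrier by (simp add: m_assoc subset_iff)
  ultimately show ?thesis
    using dimension_image[OF k_carrier _ _ _ _ assms(1), of "\<lambda>x. x \<otimes> a"] assms(2)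
    by (auto simp: l_distr)
qed

section \<open>Dimensions of subspaces, their sums and intersections\<close>

lemma subalgebra_finite_dimension:
  "\<lbrakk> finite_dimension k F; subalgebra k E R; E \<subseteq> F \<rbrakk> \<Longrightarrow> finite_dimension k E"
  by (rule subalbegra_incl_imp_finite_dimension[OF subfield])

lemma dim_mono:
  assumes "finite_dimension k F" "finite_dimension k E" "E \<subseteq> F"
  shows "dim k E \<le> dim k F"
proof -
  obtain Vs where "independent k Vs" "length Vs = dim k E" "Span k Vs = E" "set Vs \<subseteq> carrier R"
    using exists_base[OF subfield dimension_dim[OF assms(2)]] by blast
  then show ?thesis
    using independent_length_le_dimension[OF subfield dimension_dim[OF assms(1)]] assms(3)
      Span_base_incl[OF subfield] by (metis subset_trans)
qed

lemma dim_eq_imp_eq: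
  assumes "finite_dimension k F" "finite_dimension k E" "E \<subseteq> F" "dim k F \<le> dim k E"
  shows "E = F"
proof -
  obtain Vs where Vs: "independent k Vs" "length Vs = dim k E" "Span k Vs = E" "set Vs \<subseteq> carrier R"
    using exists_base[OF subfield dimension_dim[OF assms(2)]] by blast
  moreover have "dim k E = dim k F" using dim_mono[OF assms(1-3)] assms(4) by simp
  moreover have "set Vs \<subseteq> F" using Vs Span_base_incl[OF subfield] assms(3) by blast
  ultimately show ?thesis
    using independent_length_eq_dimension[OF subfield dimension_dim[OF assms(1)]] by metis
qed

lemma finite_dimension_inter:
  assumes "finite_dimension k E" "finite_dimension k F"
  shows "finite_dimension k (E \<inter> F)"
  using assms subalgebra_inter finite_dimension_subalgebra subalgebra_finite_dimension
  by (metis inf_le1)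

lemma finite_dimension_sum:
  assumes "finite_dimension k E" "finite_dimension k F"
  shows "finite_dimension k (E <+>\<^bsub>R\<^esub> F)"
  using sum_space_dim(1)[OF subfield assms] .

text \<open>The library formula subtracts natural numbers. As
  \<open>dim k (E \<inter> F) \<le> dim k E\<close>, nothing is truncated and the term can be moved
  to the other side.\<close>

lemma dim_sum_inter:
  assumes "finite_dimension k E" "finite_dimension k F"
  shows "dim k (E <+>\<^bsub>R\<^esub> F) + dim k (E \<inter> F) = dim k E + dim k F"
proof -
  have "dim k (E \<inter> F) \<le> dim k E"
    using dim_mono assms finite_dimension_inter by simp
  then show ?thesis
    using sum_space_dim(2)[OF subfield assms] by (simp add: over_def)
qed

lemma dim_zero: "dim k {\<zero>} = 0"
  by (rule dim_eqI) (rule zero_dim)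

lemma dim_pos:
  assumes "finite_dimension k E" "E \<noteq> {\<zero>}"
  shows "0 < dim k E"
  using assms dimension_dim dimension_zero[OF subfield] by (metis gr0I)

lemma finite_dimension_zero_mem: "finite_dimension k E \<Longrightarrow> \<zero> \<in> E"
  using subgroup.one_closed[OF subalgebra.axioms(1)[OF finite_dimension_subalgebra]] by simp

section \<open>Linear spans of arbitrary sets\<close>

lemma linear_span_superset:
  assumes "S \<subseteq> carrier R"
  shows "S \<subseteq> linear_span R k S"
proof
  fix s assume s: "s \<in> S"
  then have "\<one> \<otimes> s \<in> k <#> S"
    using subringE(3)[OF subfieldE(1)[OF subfield]] by (auto simp: set_mult_def)
  moreover have "\<one> \<otimes> s = s" using s assms by auto
  ultimately show "s \<in> linear_span R k S"
    unfolding linear_span_def by (auto intro: generate.incl)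
qed

lemma linear_span_subalgebra:
  assumes S: "S \<subseteq> carrier R"
  shows "subalgebra k (linear_span R k S) R"
proof -
  have kS: "k <#> S \<subseteq> carrier R"
    using S k_carrier by (auto simp: set_mult_def)
  have sub: "subgroup (linear_span R k S) (add_monoid R)"
    unfolding linear_span_def using kS by (intro add.generate_is_subgroup) auto
  have "c \<otimes> x \<in> linear_span R k S" if c: "c \<in> k" and x: "x \<in> linear_span R k S" for c x
  proof -
    \<comment> \<open>The span is only generated additively, so closure under the scalar
      \<open>c\<close> needs an argument: the elements that \<open>c\<close> multiplies into the
      span form a subgroup, and this subgroup contains the generators.\<close>
    have "subgroup {x \<in> carrier R. c \<otimes> x \<in> linear_span R k S} (add_monoid R)"
      using subgroup_add_vimage[OF sub, of "(\<otimes>) c"] c k_carrier by (auto simp: r_distr)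
    moreover have "k <#> S \<subseteq> {x \<in> carrier R. c \<otimes> x \<in> linear_span R k S}"
    proof
      fix y assume y: "y \<in> k <#> S"
      then obtain b s where bs: "b \<in> k" "s \<in> S" "y = b \<otimes> s" by (auto simp: set_mult_def)
      then have "c \<otimes> y = (c \<otimes> b) \<otimes> s" using c k_carrier S by (simp add: m_assoc subset_iff)
      moreover have "c \<otimes> b \<in> k"
        using subringE(6)[OF subfieldE(1)[OF subfield]] c bs by blast
      ultimately have "c \<otimes> y \<in> k <#> S" using bs by (auto simp: set_mult_def)
      then show "y \<in> {x \<in> carrier R. c \<otimes> x \<in> linear_span R k S}"
        using y kS unfolding linear_span_def by (auto intro: generate.incl)
    qed
    ultimately have "linear_span R k S \<subseteq> {x \<in> carrier R. c \<otimes> x \<in> linear_span R k S}"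
      unfolding linear_span_def by (intro add.generate_subgroup_incl) auto
    then show ?thesis using x by auto
  qed
  then show ?thesis using sub by (simp add: subalgebra_def subalgebra_axioms_def)
qed

lemma linear_span_minimal:
  assumes "subalgebra k E R" "S \<subseteq> E"
  shows "linear_span R k S \<subseteq> E"
  unfolding linear_span_def
proof (rule add.generate_subgroup_incl)
  show "subgroup E (add_monoid R)" by (rule subalgebra.axioms(1)[OF assms(1)])
  show "k <#> S \<subseteq> E"
    using assms(2) subalgebra.smult_closed[OF assms(1)] by (auto simp: set_mult_def)
qed

lemma finite_dimension_spanning:
  assumes "finite_dimension k E"
  obtains Us where "set Us \<subseteq> E" "Span k Us = E"
proof -
  obtain Us where "set Us \<subseteq> carrier R" "Span k Us = E"
    using exists_base[OF subfield dimension_dim[OF assms]] by blast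
  then show ?thesis using that Span_base_incl[OF subfield] by blast
qed

section \<open>Products of subspaces\<close>

definition span_prod :: "'a set \<Rightarrow> 'a set \<Rightarrow> 'a set"
  where "span_prod U V = linear_span R k (U <#> V)"

lemma mult_mem_span_prod:
  assumes "U \<subseteq> carrier R" "V \<subseteq> carrier R" "u \<in> U" "v \<in> V"
  shows "u \<otimes> v \<in> span_prod U V"
proof -
  have "U <#> V \<subseteq> carrier R" "u \<otimes> v \<in> U <#> V"
    using assms by (auto simp: set_mult_def)
  then show ?thesis unfolding span_prod_def using linear_span_superset by blast
qed

lemma span_prod_minimal:
  assumes "subalgebra k E R" "\<And>u v. u \<in> U \<Longrightarrow> v \<in> V \<Longrightarrow> u \<otimes> v \<in> E"
  shows "span_prod U V \<subseteq> E"
  unfolding span_prod_def using assms by (intro linear_span_minimal) (auto simp: set_mult_def)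

lemma span_prod_subalgebra:
  assumes "U \<subseteq> carrier R" "V \<subseteq> carrier R"
  shows "subalgebra k (span_prod U V) R"
  unfolding span_prod_def using assms by (intro linear_span_subalgebra) (auto simp: set_mult_def)

text \<open>The finitely many products of members of two spanning lists span a space
  \<open>E\<close>. Linearity in the left factor, with the right one still in its list, and then
  linearity in the right factor put every product into \<open>E\<close>.\<close>

lemma finite_dimension_span_prod:
  assumes U: "finite_dimension k U" and V: "finite_dimension k V"
  shows "finite_dimension k (span_prod U V)"
proof -
  obtain Us where Us: "set Us \<subseteq> U" "Span k Us = U" using finite_dimension_spanning[OF U] .
  obtain Vs where Vs: "set Vs \<subseteq> V" "Span k Vs = V" using finite_dimension_spanning[OF V] .
  have carr: "U \<subseteq> carrier R" "V \<subseteq> carrier R"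
    using U V finite_dimension_carrier by auto
  define Ps where "Ps = [u \<otimes> v. u \<leftarrow> Us, v \<leftarrow> Vs]"
  have Ps: "set Ps \<subseteq> carrier R"
    using Us(1) Vs(1) carr by (fastforce simp: Ps_def)
  define E where "E = Span k Ps"
  have E: "subalgebra k E R" "finite_dimension k E"
    unfolding E_def using Span_is_subalgebra[OF subfield Ps] Span_finite_dimension[OF subfield Ps] .
  have base: "u \<otimes> v \<in> E" if "u \<in> set Us" "v \<in> set Vs" for u v
    using Span_base_incl[OF subfield Ps] that unfolding E_def by (force simp: Ps_def)
  have "U \<subseteq> {x \<in> carrier R. x \<otimes> v \<in> E}" if "v \<in> set Vs" for v
  proof -
    have "v \<in> carrier R" using that Vs(1) carr by auto
    then have "Span k Us \<subseteq> {x \<in> carrier R. x \<otimes> v \<in> E}"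
      using base that Us(1) carr
      by (intro subalgebra_Span_incl[OF subfield] subalgebra_vimage_r_mult E) auto
    then show ?thesis using Us by simp
  qed
  then have step: "u \<otimes> v \<in> E" if "u \<in> U" "v \<in> set Vs" for u v
    using that by blast
  have "V \<subseteq> {x \<in> carrier R. u \<otimes> x \<in> E}" if "u \<in> U" for u
  proof -
    have "u \<in> carrier R" using that carr by auto
    then have "Span k Vs \<subseteq> {x \<in> carrier R. u \<otimes> x \<in> E}"
      using step that Vs(1) carr
      by (intro subalgebra_Span_incl[OF subfield] subalgebra_vimage_l_mult E) auto
    then show ?thesis using Vs by simp
  qed
  then have "span_prod U V \<subseteq> E"
    by (intro span_prod_minimal[OF E(1)]) auto
  then show ?thesis
    using subalgebra_finite_dimension[OF E(2) span_prod_subalgebra[OF carr]] by simp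
qed


lemma finite_dimension_r_coset:
  assumes "finite_dimension k U" "x \<in> carrier R - {\<zero>}"
  shows "finite_dimension k (U #> x)" "dim k (U #> x) = dim k U"
proof -
  have "U #> x = (\<lambda>h. h \<otimes> x) ` U" by (auto simp: r_coset_def)
  then have "dimension (dim k U) k (U #> x)"
    using dimension_r_mult[OF dimension_dim[OF assms(1)] assms(2)] by simp
  then show "finite_dimension k (U #> x)" "dim k (U #> x) = dim k U"
    by (auto intro: finite_dimensionI dim_eqI)
qed

text \<open>For a nonzero \<open>v\<close> in \<open>V\<close> the translate \<open>U #> v\<close>
  lies in the product and has the dimension of \<open>U\<close>.\<close>

lemma dim_le_span_prod:
  assumes U: "finite_dimension k U" and V: "finite_dimension k V" and "V \<noteq> {\<zero>}"
  shows "dim k U \<le> dim k (span_prod U V)"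
proof -
  have carr: "U \<subseteq> carrier R" "V \<subseteq> carrier R"
    using U V finite_dimension_carrier by auto
  obtain v where v: "v \<in> V" "v \<noteq> \<zero>"
    using finite_dimension_zero_mem[OF V] assms(3) by blast
  then have "v \<in> carrier R - {\<zero>}" using carr by auto
  note vU = finite_dimension_r_coset[OF U this]
  moreover have "U #> v \<subseteq> span_prod U V"
    using mult_mem_span_prod[OF carr] v by (auto simp: r_coset_def)
  ultimately show ?thesis
    using dim_mono[OF finite_dimension_span_prod[OF U V] vU(1)] by simp
qed

lemma set_add_superset:
  assumes "finite_dimension k A" "finite_dimension k B"
  shows "A \<subseteq> A <+>\<^bsub>R\<^esub> B" "B \<subseteq> A <+>\<^bsub>R\<^esub> B"
proof -
  have "A \<subseteq> carrier R" "B \<subseteq> carrier R" "\<zero> \<in> A" "\<zero> \<in> B"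
    using assms finite_dimension_carrier finite_dimension_zero_mem by auto
  then have "a \<in> A <+>\<^bsub>R\<^esub> B" if "a \<in> A" for a
    using that r_zero[of a] unfolding set_add_def' by force
  then show "A \<subseteq> A <+>\<^bsub>R\<^esub> B" by blast
  have "b \<in> A <+>\<^bsub>R\<^esub> B" if "b \<in> B" for b
    using that l_zero[of b] \<open>B \<subseteq> carrier R\<close> \<open>\<zero> \<in> A\<close> unfolding set_add_def' by force
  then show "B \<subseteq> A <+>\<^bsub>R\<^esub> B" by blast
qed

section \<open>The submodular function \<open>c\<close> and its atoms\<close>

definition excess :: "real \<Rightarrow> 'a set \<Rightarrow> 'a set \<Rightarrow> real"
  where "excess \<mu> V U = real (dim k (span_prod U V)) - \<mu> * real (dim k U)"

text \<open>Write \<open>AV\<close> for \<open>span_prod A V\<close>. The product of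
  \<open>A + B\<close> with \<open>V\<close> lies in \<open>AV + BV\<close>, and that of the
  intersection lies in both \<open>AV\<close> and \<open>BV\<close>; the dimension formula for
  \<open>AV\<close> and \<open>BV\<close> bounds the first terms. The terms with \<mu> balance
  exactly, by the dimension formula for \<open>A\<close> and \<open>B\<close>.\<close>

lemma excess_submodular:
  assumes A: "finite_dimension k A" and B: "finite_dimension k B" and V: "finite_dimension k V"
  shows "excess \<mu> V (A <+>\<^bsub>R\<^esub> B) + excess \<mu> V (A \<inter> B) \<le> excess \<mu> V A + excess \<mu> V B"
proof -
  have carr: "A \<subseteq> carrier R" "B \<subseteq> carrier R" "V \<subseteq> carrier R"
    using A B V finite_dimension_carrier by auto
  let ?AV = "span_prod A V" and ?BV = "span_prod B V"
  have fd: "finite_dimension k ?AV" "finite_dimension k ?BV"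
    using A B V by (simp_all add: finite_dimension_span_prod)
  have "span_prod (A \<inter> B) V \<subseteq> ?AV \<inter> ?BV"
    using fd carr
    by (intro span_prod_minimal finite_dimension_subalgebra finite_dimension_inter)
      (auto intro: mult_mem_span_prod)
  then have inter: "dim k (span_prod (A \<inter> B) V) \<le> dim k (?AV \<inter> ?BV)"
    using fd A B V
    by (intro dim_mono) (auto intro: finite_dimension_span_prod finite_dimension_inter)
  have "span_prod (A <+>\<^bsub>R\<^esub> B) V \<subseteq> ?AV <+>\<^bsub>R\<^esub> ?BV"
  proof (rule span_prod_minimal)
    show "subalgebra k (?AV <+>\<^bsub>R\<^esub> ?BV) R"
      using fd by (intro finite_dimension_subalgebra finite_dimension_sum)
    fix u v assume "u \<in> A <+>\<^bsub>R\<^esub> B" and v: "v \<in> V"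
    then obtain a b where ab: "a \<in> A" "b \<in> B" "u = a \<oplus> b" by (auto simp: set_add_def')
    then have "u \<otimes> v = a \<otimes> v \<oplus> b \<otimes> v" using carr v by (auto simp: l_distr subset_iff)
    then show "u \<otimes> v \<in> ?AV <+>\<^bsub>R\<^esub> ?BV"
      using ab(1,2) v carr by (auto intro: set_add_memI mult_mem_span_prod)
  qed
  then have sum: "dim k (span_prod (A <+>\<^bsub>R\<^esub> B) V) \<le> dim k (?AV <+>\<^bsub>R\<^esub> ?BV)"
    using fd A B V
    by (intro dim_mono) (auto intro: finite_dimension_span_prod finite_dimension_sum)
  have "dim k (span_prod (A <+>\<^bsub>R\<^esub> B) V) + dim k (span_prod (A \<inter> B) V) \<le> dim k ?AV + dim k ?BV"
    using inter sum dim_sum_inter[OF fd] by linarith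
  then have *: "real (dim k (span_prod (A <+>\<^bsub>R\<^esub> B) V)) + real (dim k (span_prod (A \<inter> B) V))
      \<le> real (dim k ?AV) + real (dim k ?BV)"
    by linarith
  have "real (dim k (A <+>\<^bsub>R\<^esub> B)) + real (dim k (A \<inter> B)) = real (dim k A) + real (dim k B)"
    using dim_sum_inter[OF A B] by linarith
  then have "\<mu> * real (dim k (A <+>\<^bsub>R\<^esub> B)) + \<mu> * real (dim k (A \<inter> B))
      = \<mu> * real (dim k A) + \<mu> * real (dim k B)"
    by (metis distrib_left)
  then show ?thesis using * unfolding excess_def by linarith
qed

text \<open>The zero subspace is kept out of the competition because its excess is 0, while for
  \<mu> < 1 and nonzero \<open>V\<close> every nonzero subspace of finite dimension has positive
  excess. Infinite-dimensional subspaces are kept out because \<open>dim\<close> means nothing for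
  them.\<close>

definition is_atom :: "real \<Rightarrow> 'a set \<Rightarrow> 'a set \<Rightarrow> bool"
  where "is_atom \<mu> V A \<longleftrightarrow> finite_dimension k A \<and> A \<noteq> {\<zero>} \<and>
    (\<forall>U. finite_dimension k U \<longrightarrow> U \<noteq> {\<zero>} \<longrightarrow>
      excess \<mu> V A \<le> excess \<mu> V U \<and> (excess \<mu> V U = excess \<mu> V A \<longrightarrow> dim k A \<le> dim k U))"

text \<open>Real values need not attain an infimum, so finiteness has to come from the dimensions.
  As \<open>(1 - \<mu>) * dim k U\<close> is at most the excess of \<open>U\<close>, the subspaces
  doing at least as well as \<open>W\<close> have bounded \<open>dim k U\<close> and bounded
  \<open>dim k (span_prod U V)\<close>. The excess depends on this pair alone, hence takes finitely
  many values on them.\<close>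

lemma ex_atom:
  assumes V: "finite_dimension k V" "V \<noteq> {\<zero>}" and "\<mu> < 1"
    and W: "finite_dimension k W" "W \<noteq> {\<zero>}"
  shows "\<exists>A. is_atom \<mu> V A"
proof -
  define \<F> where
    "\<F> = {U. finite_dimension k U \<and> U \<noteq> {\<zero>} \<and> excess \<mu> V U \<le> excess \<mu> V W}"
  define d where "d U = (dim k U, dim k (span_prod U V))" for U
  define e where "e = (\<lambda>(m, n). real n - \<mu> * real m)"
  have e: "excess \<mu> V U = e (d U)" for U by (simp add: excess_def e_def d_def)
  define N where "N = nat \<lceil>excess \<mu> V W / (1 - \<mu>)\<rceil>"
  define M where "M = nat \<lceil>excess \<mu> V W + real N\<rceil>"
  have "d ` \<F> \<subseteq> {..N} \<times> {..M}"
  proof (rule image_subsetI)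
    fix U assume U: "U \<in> \<F>"
    have "real (dim k U) \<le> real (dim k (span_prod U V))"
      using dim_le_span_prod[of U V] U V by (simp add: \<F>_def)
    moreover have ex: "real (dim k (span_prod U V)) - \<mu> * real (dim k U) \<le> excess \<mu> V W"
      using U by (simp add: \<F>_def excess_def)
    ultimately have "real (dim k U) * (1 - \<mu>) \<le> excess \<mu> V W" by (simp add: algebra_simps)
    then have "real (dim k U) \<le> excess \<mu> V W / (1 - \<mu>)"
      using \<open>\<mu> < 1\<close> by (simp add: pos_le_divide_eq)
    then have N: "dim k U \<le> N" unfolding N_def by linarith
    have "\<mu> * real (dim k U) \<le> 1 * real (dim k U)"
      using \<open>\<mu> < 1\<close> by (intro mult_right_mono) auto
    then have "real (dim k (span_prod U V)) \<le> excess \<mu> V W + real N"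
      using ex N by linarith
    then have "dim k (span_prod U V) \<le> M" unfolding M_def by linarith
    with N show "d U \<in> {..N} \<times> {..M}" by (simp add: d_def)
  qed
  then have "finite (d ` \<F>)" by (rule finite_subset) simp
  moreover have "W \<in> \<F>" using W by (simp add: \<F>_def)
  ultimately have "finite (e ` d ` \<F>)" "e ` d ` \<F> \<noteq> {}" by auto
  note Min = Min_in[OF this] Min_le[OF this(1)]
  \<comment> \<open>First the least excess is attained, by \<open>A\<^sub>0\<close>; then
    \<open>A\<close> has least dimension among the members of \<open>\<F>\<close> attaining
    it.\<close>
  obtain A\<^sub>0 where "A\<^sub>0 \<in> \<F>" "e (d A\<^sub>0) = Min (e ` d ` \<F>)"
    using Min(1) by (metis (no_types, lifting) imageE)
  then have A\<^sub>0: "A\<^sub>0 \<in> \<F>" "\<And>U. U \<in> \<F> \<Longrightarrow> e (d A\<^sub>0) \<le> e (d U)"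
    using Min(2) by auto
  obtain A where A: "A \<in> \<F>" "e (d A) = e (d A\<^sub>0)"
      "\<And>U. U \<in> \<F> \<Longrightarrow> e (d U) = e (d A\<^sub>0) \<Longrightarrow> dim k A \<le> dim k U"
    using ex_has_least_nat[of "\<lambda>U. U \<in> \<F> \<and> e (d U) = e (d A\<^sub>0)" A\<^sub>0 "dim k"] A\<^sub>0(1) by metis
  have "excess \<mu> V A \<le> excess \<mu> V U \<and> (excess \<mu> V U = excess \<mu> V A \<longrightarrow> dim k A \<le> dim k U)"
    if U: "finite_dimension k U" "U \<noteq> {\<zero>}" for U
  proof (cases "U \<in> \<F>")
    case True
    then show ?thesis using A A\<^sub>0 by (simp add: e)
  next
    \<comment> \<open>Outside \<open>\<F>\<close> the excess is larger than that of
      \<open>W\<close>, which is at least that of \<open>A\<close>.\<close>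
    case False
    then have "excess \<mu> V W < excess \<mu> V U" using U by (simp add: \<F>_def)
    then show ?thesis using A(1) by (auto simp: \<F>_def)
  qed
  then have "is_atom \<mu> V A" using A(1) by (auto simp: is_atom_def \<F>_def)
  then show ?thesis ..
qed

text \<open>Submodularity together with \<open>c(B) \<le> c(A + B)\<close> leaves
  \<open>c(A \<inter> B) \<le> c(A)\<close>. So the nonzero intersection is itself a minimiser, and
  since \<open>A\<close> has least dimension it cannot be smaller than \<open>A\<close>. Exchanging
  \<open>A\<close> and \<open>B\<close> gives equality of atoms that meet nontrivially.\<close>

lemma atom_subset:
  assumes A: "is_atom \<mu> V A" and B: "is_atom \<mu> V B" and V: "finite_dimension k V"
    and "A \<inter> B \<noteq> {\<zero>}"
  shows "A \<subseteq> B"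
proof -
  have fd: "finite_dimension k A" "finite_dimension k B" using A B by (auto simp: is_atom_def)
  \<comment> \<open>Minimality of \<open>B\<close> compares it with nonzero subspaces only.\<close>
  have "A <+>\<^bsub>R\<^esub> B \<noteq> {\<zero>}"
    using set_add_superset[OF fd] finite_dimension_zero_mem[OF fd(1)]
      finite_dimension_zero_mem[OF fd(2)] assms(4) by blast
  then have "excess \<mu> V B \<le> excess \<mu> V (A <+>\<^bsub>R\<^esub> B)"
    using B finite_dimension_sum[OF fd] by (simp add: is_atom_def)
  then have "excess \<mu> V (A \<inter> B) \<le> excess \<mu> V A"
    using excess_submodular[OF fd V, of \<mu>] by linarith
  then have "dim k A \<le> dim k (A \<inter> B)"
    using A finite_dimension_inter[OF fd] assms(4) unfolding is_atom_def by (meson order_antisym)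
  then have "A \<inter> B = A"
    using dim_eq_imp_eq[OF fd(1) finite_dimension_inter[OF fd]] by auto
  then show ?thesis by blast
qed

text \<open>One inclusion is enough: \<open>(aA)V\<close> lies in \<open>a(AV)\<close>, so the
  translate has excess at most that of \<open>A\<close>, and minimality of \<open>A\<close> turns
  this into equality.\<close>

lemma atom_l_mult:
  assumes A: "is_atom \<mu> V A" and V: "finite_dimension k V" and a: "a \<in> carrier R - {\<zero>}"
  shows "is_atom \<mu> V ((\<otimes>) a ` A)"
proof -
  have fdA: "finite_dimension k A" using A by (simp add: is_atom_def)
  have carr: "A \<subseteq> carrier R" "V \<subseteq> carrier R"
    using fdA V finite_dimension_carrier by auto
  have dim_A: "dimension (dim k A) k ((\<otimes>) a ` A)"
    using dimension_l_mult[OF dimension_dim[OF fdA] a] .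
  then have fd: "finite_dimension k ((\<otimes>) a ` A)" and d: "dim k ((\<otimes>) a ` A) = dim k A"
    by (auto intro: finite_dimensionI dim_eqI)
  have fdAV: "finite_dimension k (span_prod A V)" by (rule finite_dimension_span_prod[OF fdA V])
  have dim_AV: "dimension (dim k (span_prod A V)) k ((\<otimes>) a ` span_prod A V)"
    using dimension_l_mult[OF dimension_dim[OF fdAV] a] .
  have "span_prod ((\<otimes>) a ` A) V \<subseteq> (\<otimes>) a ` span_prod A V"
  proof (rule span_prod_minimal)
    show "subalgebra k ((\<otimes>) a ` span_prod A V) R"
      using dim_AV by (intro finite_dimension_subalgebra finite_dimensionI)
    fix u v assume "u \<in> (\<otimes>) a ` A" and v: "v \<in> V"
    then obtain b where b: "b \<in> A" "u = a \<otimes> b" by auto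
    then have "u \<otimes> v = a \<otimes> (b \<otimes> v)" using a carr v by (simp add: m_assoc subset_iff)
    then show "u \<otimes> v \<in> (\<otimes>) a ` span_prod A V"
      using mult_mem_span_prod[OF carr b(1) v] by simp
  qed
  then have "dim k (span_prod ((\<otimes>) a ` A) V) \<le> dim k (span_prod A V)"
    using dim_mono[OF finite_dimensionI[OF dim_AV] finite_dimension_span_prod[OF fd V]]
      dim_eqI[OF dim_AV] by simp
  then have le: "excess \<mu> V ((\<otimes>) a ` A) \<le> excess \<mu> V A"
    using d by (simp add: excess_def)
  have "dim k A \<noteq> 0" using A dim_pos by (auto simp: is_atom_def)
  then have nz: "(\<otimes>) a ` A \<noteq> {\<zero>}" using d dim_zero by metis
  then have "excess \<mu> V ((\<otimes>) a ` A) = excess \<mu> V A"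
    using A fd le unfolding is_atom_def by (meson order_antisym)
  then show ?thesis using A fd nz d unfolding is_atom_def by simp
qed

text \<open>
  The translates \<open>h\<^sup>-\<^sup>1H\<close> of an atom \<open>H\<close> containing \<open>\<one>\<close> are again atoms containing \<open>\<one>\<close>
  and hence equal to \<open>H\<close>.
\<close>

lemma ex_atom_sub_skew_field:
  assumes V: "finite_dimension k V" "V \<noteq> {\<zero>}" and "\<mu> < 1"
    and W: "finite_dimension k W" "W \<noteq> {\<zero>}"
  shows "\<exists>H. is_atom \<mu> V H \<and> sub_skew_field H R \<and> k \<subseteq> H"
proof -
  obtain A where A: "is_atom \<mu> V A" using ex_atom[OF assms] ..
  then have fdA: "finite_dimension k A" and "A \<noteq> {\<zero>}" by (auto simp: is_atom_def)
  then obtain a where a: "a \<in> A" "a \<noteq> \<zero>" using finite_dimension_zero_mem by blast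
  then have a_carr: "a \<in> carrier R" using finite_dimension_carrier[OF fdA] by blast
  \<comment> \<open>Dividing by a nonzero element \<open>a\<close> of the atom produces an atom that
    contains \<open>\<one>\<close>.\<close>
  define H where "H = (\<otimes>) (inv a) ` A"
  have atom: "is_atom \<mu> V H"
    unfolding H_def using A V(1) inv_nonzero(1,2)[OF a_carr a(2)] by (intro atom_l_mult) auto
  then have fdH: "finite_dimension k H" by (simp add: is_atom_def)
  note H_carr = finite_dimension_carrier[OF fdH]
  have one_H: "\<one> \<in> H"
    unfolding H_def using a(1) inv_nonzero(3)[OF a_carr a(2)] by force
  have one_nz: "\<one> \<noteq> \<zero>" using subfieldE(6)[OF subfield] .
  have eq: "(\<otimes>) (inv h) ` H = H" if h: "h \<in> H" "h \<noteq> \<zero>" for h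
  proof -
    have h_carr: "h \<in> carrier R" using h H_carr by blast
    have atom': "is_atom \<mu> V ((\<otimes>) (inv h) ` H)"
      using atom V(1) inv_nonzero(1,2)[OF h_carr h(2)] by (intro atom_l_mult) auto
    have "\<one> \<in> (\<otimes>) (inv h) ` H"
      using h(1) inv_nonzero(3)[OF h_carr h(2)] by force
    then have "(\<otimes>) (inv h) ` H \<inter> H \<noteq> {\<zero>}" "H \<inter> (\<otimes>) (inv h) ` H \<noteq> {\<zero>}"
      using one_H one_nz by auto
    then show ?thesis
      using atom_subset[OF atom' atom V(1)] atom_subset[OF atom atom' V(1)] by blast
  qed
  have inv_H: "inv h \<in> H" if h: "h \<in> H" "h \<noteq> \<zero>" for h
  proof -
    have "inv h \<otimes> \<one> \<in> H" using eq[OF h] one_H by blast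
    then show ?thesis using inv_nonzero(1)[of h] h H_carr by auto
  qed
  have mult_H: "a \<otimes> b \<in> H" if ab: "a \<in> H" "b \<in> H" for a b
  proof (cases "a = \<zero>")
    case True
    then show ?thesis
      using ab H_carr finite_dimension_zero_mem[OF fdH] by auto
  next
    case False
    \<comment> \<open>The product lies in \<open>aH\<close>, and \<open>aH = H\<close> is the fact
      \<open>eq\<close> for the element \<open>inv a\<close>, whose inverse is
      \<open>a\<close>.\<close>
    then have a: "inv a \<noteq> \<zero>" "inv (inv a) = a"
      using inv_nonzero[of a] ab(1) H_carr by auto
    then show ?thesis using eq[OF inv_H[OF ab(1) False] a(1)] ab(2) by (auto simp: a(2))
  qed
  note sub = subalgebra.axioms(1)[OF finite_dimension_subalgebra[OF fdH]]
  have subring: "subring H R"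
    using H_carr one_H mult_H add.subgroupE(3,4)[OF sub] by (intro subringI) auto
  have "Units (R \<lparr> carrier := H \<rparr>) = H - {\<zero>}"
  proof (intro equalityI subsetI)
    fix h assume "h \<in> Units (R \<lparr> carrier := H \<rparr>)"
    then obtain g where "h \<in> H" "g \<in> H" "g \<otimes> h = \<one>" by (auto simp: Units_def)
    then show "h \<in> H - {\<zero>}" using one_nz H_carr by (auto simp: subset_iff)
  next
    fix h assume "h \<in> H - {\<zero>}"
    then show "h \<in> Units (R \<lparr> carrier := H \<rparr>)"
      using inv_H[of h] inv_nonzero(3,4)[of h] H_carr by (auto simp: Units_def)
  qed
  then have "sub_skew_field H R"
    using subring by (simp add: sub_skew_field_def sub_skew_field_axioms_def)
  moreover have "k \<subseteq> H"
  proof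
    fix c assume c: "c \<in> k"
    then have "c \<otimes> \<one> \<in> H"
      using one_H subalgebra.smult_closed[OF finite_dimension_subalgebra[OF fdH]] by blast
    then show "c \<in> H" using c k_carrier by auto
  qed
  ultimately show ?thesis using atom by blast
qed

text \<open>In effect \<open>X\<close> is a basis, chosen from \<open>V\<close>, of the left
  \<open>H\<close>-space spanned by \<open>HV\<close>. It arises as a family of largest cardinality
  among the direct ones, which are bounded by the dimension over \<open>k\<close> of that
  space.\<close>

lemma ex_direct_family:
  assumes H: "sub_skew_field H R" "k \<subseteq> H" "finite_dimension k H" and V: "finite_dimension k V"
  shows "\<exists>X. finite X \<and> X \<subseteq> V - {\<zero>} \<and> is_direct_sum R X (\<lambda>x. H #> x) \<and>
    V \<subseteq> family_sum R X (\<lambda>x. H #> x) \<and> finite_dimension k (family_sum R X (\<lambda>x. H #> x)) \<and>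
    dim k (family_sum R X (\<lambda>x. H #> x)) = card X * dim k H \<and>
    card X * dim k H \<le> dim k (span_prod H V)"
proof -
  define S where "S X = family_sum R X (\<lambda>x. H #> x)" for X
  \<comment> \<open>Two clauses serve the extension step: \<open>X \<subseteq> S X\<close> shows
    that an element outside the sum is a new index, and closure under left multiplication by
    \<open>H\<close> makes its coset independent of the sum.\<close>
  define good where "good X \<longleftrightarrow> finite X \<and> X \<subseteq> V - {\<zero>} \<and> is_direct_sum R X (\<lambda>x. H #> x) \<and>
    finite_dimension k (S X) \<and> dim k (S X) = card X * dim k H \<and> X \<subseteq> S X \<and>
    S X \<subseteq> span_prod H V \<and> (\<forall>h\<in>H. \<forall>s\<in>S X. h \<otimes> s \<in> S X)" for X
  have carr: "H \<subseteq> carrier R" "V \<subseteq> carrier R"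
    using H V finite_dimension_carrier by auto
  interpret H: sub_skew_field H R by (rule H(1))
  have H_sub: "subring H R" by (rule H.subring_axioms)
  have fdHV: "finite_dimension k (span_prod H V)" by (rule finite_dimension_span_prod[OF H(3) V])
  have one_nz: "\<one> \<noteq> \<zero>" using subfieldE(6)[OF subfield] .
  then have "H \<noteq> {\<zero>}" using subringE(3)[OF H_sub] by blast
  then have H_pos: "0 < dim k H" by (rule dim_pos[OF H(3)])
  have good_card: "card X * dim k H \<le> dim k (span_prod H V)" if "good X" for X
    using that dim_mono[OF fdHV] by (metis good_def)
  have "good {}"
    using finite_dimension_zero_mem[OF fdHV] carr
    by (auto simp: good_def S_def family_sum_empty is_direct_sum_def dim_zero
        intro: finite_dimensionI zero_dim)
  moreover have "card X \<le> dim k (span_prod H V)" if "good X" for X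
    using good_card[OF that] H_pos by (metis le_trans mult.right_neutral mult_le_mono2 Suc_leI One_nat_def)
  \<comment> \<open>The successor turns the bound on the cardinalities into a strict one.\<close>
  ultimately obtain X where X: "good X" and max: "\<And>Y. good Y \<Longrightarrow> card Y \<le> card X"
    using ex_has_greatest_nat[of good "{}" card "Suc (dim k (span_prod H V))"]
    by (metis less_Suc_eq_le)
  have fin: "finite X" and XV: "X \<subseteq> V - {\<zero>}" and direct: "is_direct_sum R X (\<lambda>x. H #> x)"
    and fdS: "finite_dimension k (S X)" and dimS: "dim k (S X) = card X * dim k H"
    and XS: "X \<subseteq> S X" and SHV: "S X \<subseteq> span_prod H V"
    and HS: "\<And>h s. h \<in> H \<Longrightarrow> s \<in> S X \<Longrightarrow> h \<otimes> s \<in> S X"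
    using X by (auto simp: good_def)
  have "V \<subseteq> S X"
  proof (rule ccontr)
    assume "\<not> V \<subseteq> S X"
    then obtain x where x: "x \<in> V" "x \<notin> S X" by blast
    have x_nz: "x \<in> carrier R - {\<zero>}"
      using x finite_dimension_zero_mem[OF fdS] carr by auto
    have "x \<notin> X" using x XS by blast
    note Hx = finite_dimension_r_coset[OF H(3) x_nz]
    have S_carr: "S X \<subseteq> carrier R" by (rule finite_dimension_carrier[OF fdS])
    \<comment> \<open>A nonzero common element \<open>h \<otimes> x\<close> would give
      \<open>x = inv h \<otimes> (h \<otimes> x)\<close> in the sum, because \<open>inv h\<close> is
      again in \<open>H\<close>.\<close>
    have disj: "(H #> x) \<inter> S X = {\<zero>}"
    proof -
      have "y = \<zero>" if y: "y \<in> H #> x" "y \<in> S X" for y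
      proof (rule ccontr)
        assume "y \<noteq> \<zero>"
        obtain h where h: "h \<in> H" "y = h \<otimes> x" using y(1) by (auto simp: r_coset_def)
        then have h_nz: "h \<in> carrier R" "h \<noteq> \<zero>" using \<open>y \<noteq> \<zero>\<close> x_nz carr by auto
        have "inv h \<otimes> (h \<otimes> x) \<in> S X"
          using HS[OF sub_skew_field_nonzero_inv[OF skew_field_axioms H(1) h(1) h_nz(2)]] y(2) h(2)
          by simp
        moreover have "inv h \<otimes> (h \<otimes> x) = x"
          using inv_nonzero[OF h_nz] h_nz x_nz by (simp add: m_assoc[symmetric])
        ultimately show False using x by simp
      qed
      then show ?thesis
        using finite_dimension_zero_mem[OF fdS] finite_dimension_zero_mem[OF Hx(1)] by blast
    qed
    have coset: "finite_dimension k (H #> y)" if "y \<in> insert x X" for y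
    proof -
      have "y \<in> carrier R - {\<zero>}" using that XV carr x_nz by auto
      then show ?thesis by (rule finite_dimension_r_coset(1)[OF H(3)])
    qed
    have S_insert: "S (insert x X) = (H #> x) <+>\<^bsub>R\<^esub> S X"
      unfolding S_def
      using family_sum_insert[OF fin \<open>x \<notin> X\<close>, of "\<lambda>x. H #> x"] coset finite_dimension_carrier
      by blast
    note super = set_add_superset[OF Hx(1) fdS, folded S_insert]
    have fd: "finite_dimension k (S (insert x X))"
      unfolding S_insert by (rule finite_dimension_sum[OF Hx(1) fdS])
    have "dim k (S (insert x X)) = card (insert x X) * dim k H"
      using dim_sum_inter[OF Hx(1) fdS] fin \<open>x \<notin> X\<close> Hx(2) dimS
      by (simp add: S_insert disj dim_zero)
    moreover have "is_direct_sum R (insert x X) (\<lambda>x. H #> x)"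
      using disj coset fdS subalgebra.axioms(1)[OF finite_dimension_subalgebra]
      by (intro is_direct_sum_insert[OF fin \<open>x \<notin> X\<close> _ direct]) (auto simp: S_def)
    moreover have "insert x X \<subseteq> S (insert x X)"
    proof -
      have "\<one> \<otimes> x \<in> H #> x" using subringE(3)[OF H_sub] by (auto simp: r_coset_def)
      then have "x \<in> H #> x" using x_nz by simp
      then show ?thesis using super XS by blast
    qed
    moreover have "S (insert x X) \<subseteq> span_prod H V"
    proof
      fix y assume "y \<in> S (insert x X)"
      then obtain h s where hs: "h \<in> H" "s \<in> S X" "y = h \<otimes> x \<oplus> s"
        unfolding S_insert by (auto simp: set_add_def' r_coset_def)
      then have "h \<otimes> x \<in> span_prod H V" "s \<in> span_prod H V"
        using SHV mult_mem_span_prod[OF carr] x by auto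
      then show "y \<in> span_prod H V"
        using hs add.subgroupE(4)[OF subalgebra.axioms(1)[OF finite_dimension_subalgebra[OF fdHV]]]
        by simp
    qed
    moreover have "g \<otimes> y \<in> S (insert x X)" if g: "g \<in> H" and y: "y \<in> S (insert x X)" for g y
    proof -
      obtain h s where hs: "h \<in> H" "s \<in> S X" "y = h \<otimes> x \<oplus> s"
        using y unfolding S_insert by (auto simp: set_add_def' r_coset_def)
      have "g \<in> carrier R" "h \<in> carrier R" "s \<in> carrier R" "x \<in> carrier R"
        using g hs carr S_carr x_nz by auto
      then have "g \<otimes> y = (g \<otimes> h) \<otimes> x \<oplus> g \<otimes> s" using hs by (simp add: r_distr m_assoc)
      moreover have "(g \<otimes> h) \<otimes> x \<in> H #> x"
        using g hs subringE(6)[OF H_sub] by (auto simp: r_coset_def)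
      ultimately show ?thesis
        unfolding S_insert using HS[OF g hs(2)] by (simp add: set_add_memI)
    qed
    ultimately have "good (insert x X)"
      using fd fin XV x x_nz unfolding good_def by blast
    then show False using max[of "insert x X"] fin \<open>x \<notin> X\<close> by simp
  qed
  then show ?thesis
    using fin XV direct fdS dimS good_card[OF X] unfolding S_def by blast
qed

end

section \<open>The numerical comparison of the atom with \<open>W\<close>\<close>

theorem theorem5p8:
  fixes K :: "('a, 'b) ring_scheme" (structure)
    and k V W :: "'a set"
    and \<epsilon> :: real
  assumes "skew_field K"
    and "subfield k K"
    and "k \<subseteq> ring_center K"
    and "subalgebra k V K" and "ring.finite_dimension K k V" and "V \<noteq> {\<zero>}"
    and "subalgebra k W K" and "ring.finite_dimension K k W"
    and "ring.dim K k W \<ge> ring.dim K k V"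
    and "0 < \<epsilon>" and "\<epsilon> < 2"
    and "real (ring.dim K k (linear_span K k (W <#> V))) \<le> (2 - \<epsilon>) * real (ring.dim K k V)"
  shows
    "(\<exists>H x. sub_skew_field H K \<and> k \<subseteq> H \<and> ring.finite_dimension K k H \<and>
        real (ring.dim K k H) \<le> (2 / \<epsilon> - 1) * real (ring.dim K k V) \<and>
        x \<in> carrier K - {\<zero>} \<and> V \<subseteq> H #> x)
     \<or>
     (\<exists>H X. sub_skew_field H K \<and> k \<subseteq> H \<and> ring.finite_dimension K k H \<and>
        real (ring.dim K k H) \<le> (2 / \<epsilon> - 1) / (2 / \<epsilon> + 1) * real (ring.dim K k V) \<and>
        finite X \<and> X \<subseteq> carrier K - {\<zero>} \<and> real (card X) \<le> 2 / \<epsilon> - 1 \<and>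
        is_direct_sum K X (\<lambda>x. H #> x) \<and> V \<subseteq> family_sum K X (\<lambda>x. H #> x))"
proof -
  interpret skew_field_extension k K
    by (rule skew_field_extension.intro[OF assms(1) skew_field_extension_axioms.intro[OF assms(2,3)]])
  \<comment> \<open>With this \<mu> one has \<open>2 - \<epsilon> = 2 * \<mu>\<close>. The
    hypotheses on \<open>W\<close> then give
    \<open>c(W) \<le> 2 * \<mu> * dim V - \<mu> * dim W\<close>, which is at most
    \<open>\<mu> * dim V\<close>.\<close>
  let ?v = "real (dim k V)" and ?\<mu> = "1 - \<epsilon> / 2"
  have v_pos: "0 < dim k V" using assms(5,6) by (rule dim_pos)
  then have "dim k W \<noteq> 0" using assms(9) by linarith
  then have W: "W \<noteq> {\<zero>}" using dim_zero by auto
  obtain H where atom: "is_atom ?\<mu> V H" and H: "sub_skew_field H K" "k \<subseteq> H"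
    using ex_atom_sub_skew_field[OF assms(5,6) _ assms(8) W, of ?\<mu>] assms(10) by auto
  have fdH: "finite_dimension k H" and "H \<noteq> {\<zero>}" using atom by (auto simp: is_atom_def)
  obtain X where X: "finite X" "X \<subseteq> V - {\<zero>}" "is_direct_sum K X (\<lambda>x. H #> x)"
      and VX: "V \<subseteq> family_sum K X (\<lambda>x. H #> x)"
      and fdX: "finite_dimension k (family_sum K X (\<lambda>x. H #> x))"
      and dimX: "dim k (family_sum K X (\<lambda>x. H #> x)) = card X * dim k H"
      and cardX: "card X * dim k H \<le> dim k (span_prod H V)"
    using ex_direct_family[OF H fdH assms(5)] by blast
  have XK: "X \<subseteq> carrier K - {\<zero>}"
    using X(2) finite_dimension_carrier[OF assms(5)] by blast
  define h m v where "h = real (dim k H)" and "m = real (card X)" and "v = ?v"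
  have h: "0 < h" using dim_pos[OF fdH \<open>H \<noteq> {\<zero>}\<close>] by (simp add: h_def)
  have v: "0 < v" using v_pos by (simp add: v_def)
  have "dim k V \<le> card X * dim k H" using dim_mono[OF fdX assms(5) VX] dimX by simp
  then have v_le: "v \<le> m * h" unfolding v_def m_def h_def by (metis of_nat_le_iff of_nat_mult)
  have "m * h \<le> real (dim k (span_prod H V))"
    using cardX unfolding m_def h_def by (metis of_nat_le_iff of_nat_mult)
  moreover have "excess ?\<mu> V H \<le> excess ?\<mu> V W"
    using atom assms(8) W by (simp add: is_atom_def)
  moreover have "real (dim k (span_prod W V)) \<le> (2 - \<epsilon>) * v"
    using assms(12) by (simp add: span_prod_def v_def)
  moreover have "?\<mu> * v \<le> ?\<mu> * real (dim k W)"
    using assms(9,11) by (intro mult_left_mono) (auto simp: v_def)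
  ultimately have key: "m * h - ?\<mu> * h \<le> (2 - \<epsilon>) * v - ?\<mu> * v"
    unfolding excess_def h_def by linarith
  have key': "(m - ?\<mu>) * h \<le> ?\<mu> * v" using key by (simp add: algebra_simps)
  \<comment> \<open>Taking out \<open>2 / \<epsilon>\<close> rewrites the two bounds with the
    denominators \<open>1 - \<mu> = \<epsilon> / 2\<close> and
    \<open>2 - \<mu> = 1 + \<epsilon> / 2\<close>, which are the values of \<open>m - \<mu>\<close>
    at \<open>m = 1\<close> and \<open>m = 2\<close>.\<close>
  have "2 / \<epsilon> - 1 = 2 / \<epsilon> * ?\<mu>" "2 / \<epsilon> + 1 = 2 / \<epsilon> * (1 + \<epsilon> / 2)"
    using assms(10) by (simp_all add: field_simps)
  moreover have "2 / \<epsilon> \<noteq> 0" using assms(10) by simp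
  ultimately have coeff: "2 / \<epsilon> - 1 = ?\<mu> / (\<epsilon> / 2)"
      "(2 / \<epsilon> - 1) / (2 / \<epsilon> + 1) = ?\<mu> / (1 + \<epsilon> / 2)"
    by (simp, metis mult_divide_mult_cancel_left)
  \<comment> \<open>Replacing \<open>v\<close> by its upper bound \<open>m * h\<close> allows
    \<open>h\<close> to be cancelled, which leaves
    \<open>(1 - \<mu>) * m \<le> \<mu>\<close>.\<close>
  have "?\<mu> * v \<le> ?\<mu> * (m * h)"
    using v_le assms(11) by (intro mult_left_mono) auto
  then have "(m - ?\<mu>) * h \<le> (?\<mu> * m) * h" using key' by (simp add: algebra_simps)
  then have "m - ?\<mu> \<le> ?\<mu> * m" using h by (simp add: mult_le_cancel_right)
  then have m_le: "m \<le> 2 / \<epsilon> - 1"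
    unfolding coeff using assms(10) by (simp add: field_simps)
  have "m \<noteq> 0" using v_le v by auto
  then have "card X \<noteq> 0" by (simp add: m_def)
  then consider "card X = 1" | "2 \<le> card X" by linarith
  then show ?thesis
  proof cases
    \<comment> \<open>A single coset gives alternative (a): here
      \<open>m - \<mu> = \<epsilon> / 2\<close> in \<open>key'\<close>.\<close>
    case 1
    then obtain x where x: "X = {x}" by (auto simp: card_1_singleton_iff)
    have Hx: "finite_dimension k (H #> x)"
      using finite_dimension_r_coset(1)[OF fdH] XK x by simp
    have "family_sum K {x} (\<lambda>x. H #> x) = (H #> x) <+>\<^bsub>K\<^esub> {\<zero>}"
      using family_sum_insert[of "{}" x "\<lambda>x. H #> x"] finite_dimension_carrier[OF Hx]
      by (simp add: family_sum_empty)
    also have "\<dots> = H #> x"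
      using finite_dimension_carrier[OF Hx] by (auto simp: set_add_def' subset_iff)
    finally have "V \<subseteq> H #> x" using VX x by simp
    moreover have "h \<le> (2 / \<epsilon> - 1) * v"
      using key' 1 assms(10) unfolding coeff m_def by (simp add: field_simps)
    ultimately show ?thesis
      using H fdH XK x unfolding h_def v_def by blast
  next
    case 2
    \<comment> \<open>Two or more cosets give alternative (b): from \<open>m \<ge> 2\<close> the
      factor \<open>m - \<mu>\<close> is at least \<open>1 + \<epsilon> / 2\<close>.\<close>
    have "(1 + \<epsilon> / 2) * h \<le> (m - ?\<mu>) * h"
      using 2 h unfolding m_def by (intro mult_right_mono) auto
    then have "(1 + \<epsilon> / 2) * h \<le> ?\<mu> * v" using key' by linarith
    then have "h \<le> (2 / \<epsilon> - 1) / (2 / \<epsilon> + 1) * v"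
      unfolding coeff(2) using assms(10) by (simp add: pos_le_divide_eq mult.commute)
    then show ?thesis
      using H fdH X XK VX m_le unfolding h_def v_def m_def by blast
  qed
qed

end
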